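(* Any surface transformation induced by an element of $\mathrm{SL}_2(\mathbb{R})$ is a composition of parallel translations, homotheties and reciprocal mappings.
   Context: The transformations act on $C^2$-smooth non-flat (Gauss curvature nowhere zero) surfaces of revolution $\mathcal{S}$ about the $z$-axis in $\mathbb{R}^3$; images may be non-regular, i.e. have points where a radius of curvature vanishes. Let $\theta$ be the angle between the oriented unit normal and the positive $z$-axis (the Gauss angle), $(\rho(\theta),h(\theta))$ the profile curve parametrised by $\theta$ ($\rho$ the signed distance from the axis, $h$ the height), and $r_1,r_2$ the radii of curvature of the parallels and of the profile curve, so that $\rho=r_1\sin\theta$ and $dh/d\theta=-r_2\sin\theta$. For $M=\begin{pmatrix}a&b\\c&d\end{pmatrix}\in\mathrm{SL}_2(\mathbb{R})$ and a constant $\mathcal{A}\in\mathbb{R}\setminus\{0\}$, the surface transformation induced by $M$ (with constant $\mathcal{A}$) sends $\mathcal{S}$ to the surface of revolution $\widetilde{\mathcal{S}}$ whose radii of curvature at corresponding points are $\widetilde r_i=\frac{ar_i+b}{cr_i+d}$, $i=1,2$, and whose Gauss angle $\widetilde\theta$ and distance from the axis $\widetilde\rho$ satisfy $\sin\widetilde\theta=\mathcal{A}(c\rho(\theta)+d\sin\theta)$, $\widetilde\rho(\widetilde\theta)=\mathcal{A}(a\rho(\theta)+b\sin\theta)$ (where the right-hand side of the first equation lies in $[-1,1]$), the height $\widetilde h$ being determined up to an additive constant by $d\widetilde h/d\widetilde\theta=-\widetilde r_2\sin\widetilde\theta$. A parallel translation moves every point of the surface a fixed distance $v\in\mathbb{R}$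 along the oriented unit normal; it is induced by $\begin{pmatrix}1&v\\0&1\end{pmatrix}$ with $\mathcal{A}=1$. A homothety is a dilation of $\mathbb{R}^3$; $\begin{pmatrix}\omega&0\\0&1/\omega\end{pmatrix}$ with $\mathcal{A}=\omega$ induces the homothety of factor $\omega^2$. A reciprocal mapping is a transformation induced by $Q=\begin{pmatrix}0&-1\\1&0\end{pmatrix}$ with any $\mathcal{A}\ne0$, i.e. $(r_1,r_2)\mapsto(-1/r_1,-1/r_2)$ with $\sin\widetilde\theta=\mathcal{A}\rho(\theta)$, $\widetilde\rho(\widetilde\theta)=-\mathcal{A}\sin\theta$.
   Formalization: For c=0 the claim is proved only on surfaces (or parts) with bounded distance from the axis, the composition depending on the bound, or for A=a with unit normals preserved; without this it fails, e.g. M=I, A=1/2 on a paraboloid, where no reciprocal mapping is defined globally. *)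

theory Defs
  imports "HOL-Analysis.Analysis"
begin

text \<open>
  A surface of revolution about the z-axis is given by its profile curve over a parameter interval
  \<open>I\<close>.  All surfaces of a chain of transformations share \<open>I\<close>: equal parameters are corresponding
  points.  The parameter is the Gauss angle of the initial surface; an image in general cannot be
  parametrised by its own Gauss angle, because the new angle may fail to be injective in the old one.
  The signed distance \<open>radial\<close> lets the profile run through the axis, so the poles are
  interior points.
\<close>

record profile =
  gauss :: "real \<Rightarrow> real"    (* Gauss angle theta *)
  radial :: "real \<Rightarrow> real"   (* signed distance rho from the axis *)
  height :: "real \<Rightarrow> real"   (* height h *)
  rad1 :: "real \<Rightarrow> real"     (* radius of curvature r1 of the parallels *)
  rad2 :: "real \<Rightarrow> real"     (* radius of curvature r2 of the profile curve *)

definition position :: "profile \<Rightarrow> real \<Rightarrow> real \<Rightarrow> real ^ 3" where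
  "position S t \<phi> = vector [radial S t * cos \<phi>, radial S t * sin \<phi>, height S t]"

definition unit_normal :: "profile \<Rightarrow> real \<Rightarrow> real \<Rightarrow> real ^ 3" where
  "unit_normal S t \<phi> =
     vector [sin (gauss S t) * cos \<phi>, sin (gauss S t) * sin \<phi>, cos (gauss S t)]"

text \<open>
  \<open>d\<rho>/d\<theta> = r\<^sub>2 cos \<theta>\<close> and \<open>dh/d\<theta> = - r\<^sub>2 sin \<theta>\<close>, multiplied by \<open>d\<theta>/dt\<close>, say that
  \<open>(sin \<theta>, cos \<theta>)\<close> is normal to the profile curve and that \<open>r\<^sub>2\<close> is its radius of curvature.
  Vanishing radii are allowed here, so these surfaces may be non-regular.
\<close>

definition revolution_surface :: "real set \<Rightarrow> profile \<Rightarrow> bool" where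
  "revolution_surface I S \<longleftrightarrow>
     open I \<and> is_interval I \<and> I \<noteq> {} \<and>
     (\<forall>t\<in>I.
        gauss S differentiable (at t) \<and>
        radial S t = rad1 S t * sin (gauss S t) \<and>
        (radial S has_real_derivative rad2 S t * cos (gauss S t) * deriv (gauss S) t) (at t) \<and>
        (height S has_real_derivative - rad2 S t * sin (gauss S t) * deriv (gauss S) t) (at t))"

text \<open>
  The surfaces that are transformed: C2-smooth, with nowhere vanishing Gauss curvature
  \<open>1 / (r\<^sub>1 r\<^sub>2)\<close>.  On such a surface the Gauss angle is a C1 parameter of the profile curve; in terms
  of it, both conditions together say that the radii of curvature are continuous and never zero.
\<close>

definition regular_surface :: "real set \<Rightarrow> profile \<Rightarrow> bool" where
  "regular_surface I S \<longleftrightarrow>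
     revolution_surface I S \<and> (\<forall>t\<in>I. gauss S t = t) \<and>
     continuous_on I (rad1 S) \<and> continuous_on I (rad2 S) \<and>
     (\<forall>t\<in>I. rad1 S t \<noteq> 0 \<and> rad2 S t \<noteq> 0)"

text \<open>
  A transformation is a relation between a surface and its image, because the height is determined
  only up to a constant and the new Gauss angle only through its sine.  It is a relation over
  \<open>I\<close>, i.e. it applies to a surface (or the part of one) on which it is defined throughout:
  the image radii are finite and the prescribed sine lies in \<open>[-1, 1]\<close>.
\<close>

type_synonym transformation = "real set \<Rightarrow> profile \<Rightarrow> profile \<Rightarrow> bool"

definition induced :: "real ^ 2 ^ 2 \<Rightarrow> real \<Rightarrow> transformation" where
  "induced M A I S S' \<longleftrightarrow>
     (let a = M $ 1 $ 1; b = M $ 1 $ 2; c = M $ 2 $ 1; d = M $ 2 $ 2 in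
      revolution_surface I S \<and> revolution_surface I S' \<and>
      (\<forall>t\<in>I.
         c * rad1 S t + d \<noteq> 0 \<and> rad1 S' t = (a * rad1 S t + b) / (c * rad1 S t + d) \<and>
         c * rad2 S t + d \<noteq> 0 \<and> rad2 S' t = (a * rad2 S t + b) / (c * rad2 S t + d) \<and>
         sin (gauss S' t) = A * (c * radial S t + d * sin (gauss S t)) \<and>
         radial S' t = A * (a * radial S t + b * sin (gauss S t))))"

text \<open>
  The inducing matrix alone fixes only the sine of the Gauss angle and the distance from the axis,
  hence would allow an additional reflection in a horizontal plane; the conditions on position and
  normal exclude it.
\<close>

definition parallel_translation :: "real \<Rightarrow> transformation" where
  "parallel_translation v I S S' \<longleftrightarrow>
     induced (vector [vector [1, v], vector [0, 1]]) 1 I S S' \<and>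
     (\<forall>t\<in>I. \<forall>\<phi>.
        position S' t \<phi> = position S t \<phi> + v *\<^sub>R unit_normal S t \<phi> \<and>
        unit_normal S' t \<phi> = unit_normal S t \<phi>)"

text \<open>
  The factor is \<open>\<omega>\<^sup>2\<close>.  The centre lies on the axis, so that the image is again a surface of
  revolution about the z-axis.
\<close>

definition homothety :: "real \<Rightarrow> transformation" where
  "homothety \<omega> I S S' \<longleftrightarrow>
     induced (vector [vector [\<omega>, 0], vector [0, 1 / \<omega>]]) \<omega> I S S' \<and>
     (\<exists>z. \<forall>t\<in>I. \<forall>\<phi>.
        position S' t \<phi> =
          vector [0, 0, z] + \<omega>\<^sup>2 *\<^sub>R (position S t \<phi> - vector [0, 0, z]) \<and>
        unit_normal S' t \<phi> = unit_normal S t \<phi>)"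

definition reciprocal :: "real \<Rightarrow> transformation" where
  "reciprocal A = induced (vector [vector [0, -1], vector [1, 0]]) A"

inductive is_composition :: "transformation \<Rightarrow> bool" where
  "is_composition (parallel_translation v)"
| "\<omega> \<noteq> 0 \<Longrightarrow> is_composition (homothety \<omega>)"
| "A \<noteq> 0 \<Longrightarrow> is_composition (reciprocal A)"
| "is_composition T \<Longrightarrow> is_composition U \<Longrightarrow> is_composition (\<lambda>I. T I OO U I)"

text \<open>
  Pitfall: every intermediate surface of a composition has to exist.  The first reciprocal mapping
  occurring in it is preceded only by parallel translations and homotheties; for its image to have
  a Gauss angle, \<open>\<rho>\<close> must be bounded.  (If \<open>c \<noteq> 0\<close>, this is already forced by
  \<open>sin \<theta>' = A (c \<rho> + d sin \<theta>)\<close>.)  Upper triangular matrices give \<open>sin \<theta>' = A d sin \<theta>\<close>; when this is not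
  \<open>sin \<theta>\<close>, reciprocal mappings are indispensable.  For example, with the identity matrix and
  \<open>A = 1 / 2\<close>, the transformation of a paraboloid of revolution is a composition only over the part
  inside a cylinder about the axis, and the composition depends on the cylinder.
\<close>

end

theory Submission
  imports Defs
begin

text \<open>
  Composition of the inducing maps corresponds to multiplication of the matrices and of the constants.
  If \<open>c \<noteq> 0\<close>, then
  \<open>(a b; c d) = (1 a/c; 0 1) (0 -1; 1 0) (c 0; 0 1/c) (1 d/c; 0 1)\<close>,
  where the two rightmost factors and the inverse of the leftmost one act on every surface, so the
  intermediate surfaces are obtained from both ends of the chain.  If \<open>c = 0\<close>, then the product of
  \<open>M\<close> with the inverse of \<open>(0 -1; 1 0)\<close> has a nonzero lower left entry, so it suffices to start with
  a reciprocal mapping; with a constant small compared with \<open>1 / \<rho>\<close>, its Gauss angle is an arcsine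
  and its height an integral.  Finally, if the normals are kept, then the image has the
  height of the image under a homothety followed by a parallel translation, up to a constant; two
  homotheties with different centres on the axis supply the constant.
\<close>

section \<open>The three generating matrices and composition of inducing maps\<close>

definition translation_matrix :: "real \<Rightarrow> real ^ 2 ^ 2" where
  "translation_matrix v = vector [vector [1, v], vector [0, 1]]"

definition scaling_matrix :: "real \<Rightarrow> real ^ 2 ^ 2" where
  "scaling_matrix \<omega> = vector [vector [\<omega>, 0], vector [0, 1 / \<omega>]]"

definition reciprocal_matrix :: "real ^ 2 ^ 2" where
  "reciprocal_matrix = vector [vector [0, -1], vector [1, 0]]"

lemma matrix_mult_2:
  fixes X Y :: "'a :: semiring_1 ^ 2 ^ 2"
  shows "(X ** Y) $ i $ j = X $ i $ 1 * Y $ 1 $ j + X $ i $ 2 * Y $ 2 $ j"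
  by (simp add: matrix_matrix_mult_def sum_2)

text \<open>If \<open>(p, q)\<close> is a row of a second matrix, the new numerator is that row of
  the matrix product applied to \<open>r\<close>. In a quotient of two such expressions the common
  denominator \<open>c * r + d\<close> cancels.\<close>

lemma linear_mobius:
  fixes r :: "'a :: field"
  assumes "c * r + d \<noteq> 0"
  shows "p * ((a * r + b) / (c * r + d)) + q = ((p * a + q * c) * r + (p * b + q * d)) / (c * r + d)"
  using assms by (simp add: divide_simps) (simp add: algebra_simps)

lemma induced_imp_revolution_surface:
  assumes "induced N B I S S'"
  shows "revolution_surface I S" "revolution_surface I S'"
  using assms by (auto simp: induced_def Let_def)

text \<open>The conditions linking \<open>S'\<close> to \<open>U\<close> are built from linear forms
  in the data of \<open>U\<close>, and each form pulls back along the first map to the corresponding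
  form in the data of \<open>S\<close>. As an equivalence this serves both to compose maps and to
  cancel a known first map.\<close>

lemma induced_mult_iff:
  assumes "induced N B I S U"
  shows "induced (N' ** N) (B' * B) I S S' \<longleftrightarrow> induced N' B' I U S'"
proof -
  define a b c d where "a = N $ 1 $ 1" "b = N $ 1 $ 2" "c = N $ 2 $ 1" "d = N $ 2 $ 2"
  note N = this
  define a' b' c' d' where "a' = N' $ 1 $ 1" "b' = N' $ 1 $ 2" "c' = N' $ 2 $ 1" "d' = N' $ 2 $ 2"
  note N' = this
  note S = induced_imp_revolution_surface[OF assms]
  have ind: "c * rad1 S t + d \<noteq> 0" "rad1 U t = (a * rad1 S t + b) / (c * rad1 S t + d)"
      "c * rad2 S t + d \<noteq> 0" "rad2 U t = (a * rad2 S t + b) / (c * rad2 S t + d)"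
      "sin (gauss U t) = B * (c * radial S t + d * sin (gauss S t))"
      "radial U t = B * (a * radial S t + b * sin (gauss S t))" if "t \<in> I" for t
    using assms that by (auto simp: induced_def Let_def N)
  have lin: "x * rad1 U t + y = ((x * a + y * c) * rad1 S t + (x * b + y * d)) / (c * rad1 S t + d)"
    "x * rad2 U t + y = ((x * a + y * c) * rad2 S t + (x * b + y * d)) / (c * rad2 S t + d)"
    "x * radial U t + y * sin (gauss U t) =
      B * ((x * a + y * c) * radial S t + (x * b + y * d) * sin (gauss S t))"
    if "t \<in> I" for t x y
    unfolding ind(2,4)[OF that] by (intro linear_mobius ind(1,3)[OF that] | simp add: ind(5,6)[OF that] algebra_simps)+
  show ?thesis
    unfolding induced_def Let_def matrix_mult_2 N[symmetric] N'[symmetric]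
    using S by (auto simp: lin ind(1,3) mult.assoc)
qed

lemma revolution_surfaceD:
  assumes "revolution_surface I S" "t \<in> I"
  shows "(gauss S has_real_derivative deriv (gauss S) t) (at t)"
    and "radial S t = rad1 S t * sin (gauss S t)"
    and "(radial S has_real_derivative rad2 S t * cos (gauss S t) * deriv (gauss S) t) (at t)"
    and "(height S has_real_derivative - rad2 S t * sin (gauss S t) * deriv (gauss S) t) (at t)"
  using assms by (auto simp: revolution_surface_def DERIV_deriv_iff_real_differentiable)

section \<open>Parallel surfaces and dilated surfaces\<close>

definition offset :: "real \<Rightarrow> profile \<Rightarrow> profile" where
  "offset v S = \<lparr>gauss = gauss S, radial = \<lambda>t. radial S t + v * sin (gauss S t),
     height = \<lambda>t. height S t + v * cos (gauss S t),
     rad1 = \<lambda>t. rad1 S t + v, rad2 = \<lambda>t. rad2 S t + v\<rparr>"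

text \<open>Here \<open>k\<close> is the actual factor of the dilation, hence
  \<open>\<omega>\<^sup>2\<close> for \<open>homothety \<omega>\<close>; the centre is the point of
  the axis at height \<open>z\<close>.\<close>

definition dilate :: "real \<Rightarrow> real \<Rightarrow> profile \<Rightarrow> profile" where
  "dilate z k S = \<lparr>gauss = gauss S, radial = \<lambda>t. k * radial S t,
     height = \<lambda>t. z + k * (height S t - z),
     rad1 = \<lambda>t. k * rad1 S t, rad2 = \<lambda>t. k * rad2 S t\<rparr>"

lemma revolution_surface_offset:
  assumes "revolution_surface I S"
  shows "revolution_surface I (offset v S)"
proof -
  have "((\<lambda>t. radial S t + v * sin (gauss S t)) has_real_derivative
         (rad2 S t + v) * cos (gauss S t) * deriv (gauss S) t) (at t)"
    "((\<lambda>t. height S t + v * cos (gauss S t)) has_real_derivative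
         - (rad2 S t + v) * sin (gauss S t) * deriv (gauss S) t) (at t)" if "t \<in> I" for t
    by (auto intro!: derivative_eq_intros revolution_surfaceD(1,3,4)[OF assms that] simp: algebra_simps)
  with assms show ?thesis
    by (auto simp: revolution_surface_def offset_def algebra_simps)
qed

lemma revolution_surface_dilate:
  assumes "revolution_surface I S"
  shows "revolution_surface I (dilate z k S)"
proof -
  have "((\<lambda>t. k * radial S t) has_real_derivative
         k * rad2 S t * cos (gauss S t) * deriv (gauss S) t) (at t)"
    "((\<lambda>t. z + k * (height S t - z)) has_real_derivative
         - (k * rad2 S t) * sin (gauss S t) * deriv (gauss S) t) (at t)" if "t \<in> I" for t
    by (auto intro!: derivative_eq_intros revolution_surfaceD(1,3,4)[OF assms that] simp: algebra_simps)
  with assms show ?thesis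
    by (auto simp: revolution_surface_def dilate_def)
qed

lemma parallel_translation_imp_induced:
  "parallel_translation v I S S' \<Longrightarrow> induced (translation_matrix v) 1 I S S'"
  by (simp add: parallel_translation_def translation_matrix_def)

lemma homothety_imp_induced: "homothety \<omega> I S S' \<Longrightarrow> induced (scaling_matrix \<omega>) \<omega> I S S'"
  by (simp add: homothety_def scaling_matrix_def)

lemma reciprocal_eq: "reciprocal B = induced reciprocal_matrix B"
  by (simp add: reciprocal_def reciprocal_matrix_def)

text \<open>The matrix already prescribes the distance from the axis, so the horizontal coordinates
  of the position agree automatically and only the height remains.\<close>

lemma parallel_translation_iff:
  "parallel_translation v I S S' \<longleftrightarrow>
     induced (translation_matrix v) 1 I S S' \<and>
     (\<forall>t\<in>I. height S' t = height S t + v * cos (gauss S t)) \<and>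
     (\<forall>t\<in>I. \<forall>\<phi>. unit_normal S' t \<phi> = unit_normal S t \<phi>)"
  unfolding parallel_translation_def translation_matrix_def[symmetric]
  by (auto simp: position_def unit_normal_def vec_eq_iff forall_3 induced_def
      translation_matrix_def algebra_simps)

lemma homothety_iff:
  assumes "\<omega> \<noteq> 0"
  shows "homothety \<omega> I S S' \<longleftrightarrow>
     induced (scaling_matrix \<omega>) \<omega> I S S' \<and>
     (\<exists>z. \<forall>t\<in>I. height S' t = z + \<omega>\<^sup>2 * (height S t - z)) \<and>
     (\<forall>t\<in>I. \<forall>\<phi>. unit_normal S' t \<phi> = unit_normal S t \<phi>)"
  unfolding homothety_def scaling_matrix_def[symmetric] using assms
  by (auto simp: position_def unit_normal_def vec_eq_iff forall_3 induced_def
      scaling_matrix_def power2_eq_square)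

lemma parallel_translation_offset:
  assumes "revolution_surface I S"
  shows "parallel_translation v I S (offset v S)"
  using assms revolution_surface_offset[OF assms, of v]
  by (simp add: parallel_translation_iff induced_def translation_matrix_def)
     (simp add: offset_def unit_normal_def)

text \<open>Supplies a preimage of a given image, for a chain that is built backwards from its last
  surface.\<close>

lemma parallel_translation_from_offset:
  assumes "revolution_surface I S"
  shows "parallel_translation v I (offset (- v) S) S"
  using assms revolution_surface_offset[OF assms, of "- v"]
  by (simp add: parallel_translation_iff induced_def translation_matrix_def)
     (simp add: offset_def unit_normal_def)

lemma homothety_dilate:
  assumes "revolution_surface I S" "\<omega> \<noteq> 0"
  shows "homothety \<omega> I S (dilate z (\<omega>\<^sup>2) S)"
  using assms revolution_surface_dilate[OF assms(1), of z "\<omega>\<^sup>2"]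
  by (simp add: homothety_iff induced_def scaling_matrix_def)
     (auto simp: dilate_def unit_normal_def power2_eq_square)

section \<open>Matrices with nonzero lower left entry\<close>

lemma matrix_decomposition:
  fixes M :: "real ^ 2 ^ 2"
  assumes "det M = 1" "M $ 2 $ 1 \<noteq> 0"
  shows "M = translation_matrix (M $ 1 $ 1 / M $ 2 $ 1) **
    (reciprocal_matrix ** (scaling_matrix (M $ 2 $ 1) ** translation_matrix (M $ 2 $ 2 / M $ 2 $ 1)))"
  \<comment> \<open>This is the Bruhat decomposition; the determinant enters through the upper right
    entry, \<open>(a * d - 1) / c = b\<close>.\<close>
  using assms
  by (simp add: vec_eq_iff forall_2 matrix_mult_2 translation_matrix_def scaling_matrix_def
      reciprocal_matrix_def det_2 field_simps)

text \<open>The reciprocal mapping is only verified between two surfaces already at hand, so neither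
  an arcsine nor an integral arises, and one \<open>T\<close> serves all surfaces.\<close>

lemma lower_left_nonzero_is_composition:
  fixes M :: "real ^ 2 ^ 2"
  assumes M: "det M = 1" "M $ 2 $ 1 \<noteq> 0" and A: "A \<noteq> 0"
  shows "\<exists>T. is_composition T \<and> (\<forall>I S S'. induced M A I S S' \<longleftrightarrow> T I S S')"
proof -
  define c where "c = M $ 2 $ 1"
  define v where "v = M $ 1 $ 1 / c"
  define w where "w = M $ 2 $ 2 / c"
  have c: "c \<noteq> 0" using M by (simp add: c_def)
  let ?R = "reciprocal_matrix" and ?D = "scaling_matrix c"
  have M_eq: "M = translation_matrix v ** (?R ** (?D ** translation_matrix w))"
    using matrix_decomposition[OF M] by (simp add: v_def w_def c_def)
  have A_eq: "A = 1 * (A / c * (c * 1))" using c by simp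
  \<comment> \<open>The translations have constant \<open>1\<close> and the homothety has constant
    \<open>c\<close>, so the reciprocal mapping takes \<open>A / c\<close> to make the product
    \<open>A\<close>.\<close>
  define T where "T = (\<lambda>I. (\<lambda>I. (\<lambda>I. parallel_translation w I OO homothety c I) I
    OO reciprocal (A / c) I) I OO parallel_translation v I)"
  have "is_composition T"
    unfolding T_def using A c by (intro is_composition.intros) auto
  moreover have "induced M A I S S' \<longleftrightarrow> T I S S'" for I S S'
  proof
    assume "T I S S'"
    then obtain U1 U2 U3 where U: "parallel_translation w I S U1" "homothety c I U1 U2"
      "reciprocal (A / c) I U2 U3" "parallel_translation v I U3 S'"
      by (auto simp: T_def)
    have 1: "induced (translation_matrix w) 1 I S U1"
      using U(1) by (rule parallel_translation_imp_induced)
    have 2: "induced (?D ** translation_matrix w) (c * 1) I S U2"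
      unfolding induced_mult_iff[OF 1] using U(2) by (rule homothety_imp_induced)
    have 3: "induced (?R ** (?D ** translation_matrix w)) (A / c * (c * 1)) I S U3"
      unfolding induced_mult_iff[OF 2] using U(3) by (simp add: reciprocal_eq)
    have "induced M (1 * (A / c * (c * 1))) I S S'"
      unfolding M_eq induced_mult_iff[OF 3] using U(4) by (rule parallel_translation_imp_induced)
    then show "induced M A I S S'" using c by simp
  next
    assume ind: "induced M A I S S'"
    note S = induced_imp_revolution_surface[OF ind]
    define U1 where "U1 = offset w S"
    define U2 where "U2 = dilate 0 (c\<^sup>2) U1"
    define U3 where "U3 = offset (- v) S'"
    have U1: "parallel_translation w I S U1"
      unfolding U1_def by (rule parallel_translation_offset[OF S(1)])
    have U2: "homothety c I U1 U2"
      unfolding U2_def U1_def by (rule homothety_dilate[OF revolution_surface_offset[OF S(1)] c])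
    have U3: "parallel_translation v I U3 S'"
      unfolding U3_def by (rule parallel_translation_from_offset[OF S(2)])
    have "induced (?D ** translation_matrix w) (c * 1) I S U2"
      unfolding induced_mult_iff[OF parallel_translation_imp_induced[OF U1]]
      by (rule homothety_imp_induced[OF U2])
    \<comment> \<open>Regrouping isolates the right factor, which already leads from
      \<open>S\<close> to \<open>U2\<close> and can therefore be cancelled.\<close>
    moreover have "induced ((translation_matrix v ** ?R) ** (?D ** translation_matrix w))
        (A / c * (c * 1)) I S S'"
      using ind c M_eq by (simp add: matrix_mul_assoc)
    ultimately have 1: "induced (translation_matrix v ** ?R) (A / c) I U2 S'"
      by (simp only: induced_mult_iff)
    \<comment> \<open>Translating \<open>S'\<close> back to \<open>U3\<close> removes the left
      factor; what is left between \<open>U2\<close> and \<open>U3\<close> is the reciprocal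
      mapping.\<close>
    have "induced (translation_matrix (- v) ** (translation_matrix v ** ?R)) (1 * (A / c)) I U2 U3"
      unfolding induced_mult_iff[OF 1] U3_def
      by (intro parallel_translation_imp_induced parallel_translation_offset S)
    also have "translation_matrix (- v) ** (translation_matrix v ** ?R) = ?R"
      by (simp add: vec_eq_iff forall_2 matrix_mult_2 translation_matrix_def reciprocal_matrix_def)
    finally have "reciprocal (A / c) I U2 U3" by (simp add: reciprocal_eq)
    with U1 U2 U3 show "T I S S'" by (auto simp: T_def)
  qed
  ultimately show ?thesis by blast
qed

section \<open>Existence of reciprocal images and surfaces of bounded radius\<close>

lemma antiderivative_on_open_interval:
  fixes f :: "real \<Rightarrow> real"
  assumes "open I" "is_interval I" "continuous_on I f"
  shows "\<exists>F. \<forall>x\<in>I. (F has_real_derivative f x) (at x)"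
proof (cases "I = {}")
  case False
  then obtain c where c: "c \<in> I" by auto
  have "((\<lambda>u. LBINT y=c..u. f y) has_real_derivative f x) (at x)" if x: "x \<in> I" for x
  proof -
    obtain e where e: "e > 0" "{x - e..x + e} \<subseteq> I"
      using assms(1) x by (metis open_contains_cball cball_eq_atLeastAtMost)
    \<comment> \<open>The compact interval \<open>{l..u}\<close> contains the base point
      \<open>c\<close> and has \<open>x\<close> in its interior, so the derivative within it is a
      two-sided one.\<close>
    define l u where "l = min c (x - e)" and "u = max c (x + e)"
    have "x - e \<in> I" "x + e \<in> I" using e by auto
    then have "l \<in> I" "u \<in> I" using c by (simp_all add: l_def u_def min_def max_def)
    have "{l..u} \<subseteq> I"
    proof
      fix y assume "y \<in> {l..u}"
      then have "l \<le> y" "y \<le> u" by auto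
      with \<open>l \<in> I\<close> \<open>u \<in> I\<close> show "y \<in> I"
        by (rule mem_is_interval_1_I[OF assms(2)])
    qed
    then have "continuous_on {l..u} f"
      using assms(3) continuous_on_subset by blast
    then have "((\<lambda>u. LBINT y=c..u. f y) has_vector_derivative f x) (at x within {l..u})"
      using e by (intro interval_integral_FTC2) (auto simp: l_def u_def)
    moreover have "x \<in> interior {l..u}"
      using e by (auto simp: l_def u_def)
    ultimately show ?thesis
      unfolding has_real_derivative_iff_has_vector_derivative by (metis at_within_interior)
  qed
  then show ?thesis by blast
qed auto

text \<open>The strict bound keeps \<open>k * radial S t\<close> inside the open interval where
  arcsin is differentiable, so the new Gauss angle has nonzero cosine. Nonzero radii of
  \<open>S\<close> make the new radii finite.\<close>

lemma reciprocal_exists: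
  assumes S: "regular_surface I S" and small: "\<forall>t\<in>I. \<bar>k * radial S t\<bar> < 1"
  shows "\<exists>U. induced reciprocal_matrix k I S U"
proof -
  have rev: "revolution_surface I S" and g: "\<And>t. t \<in> I \<Longrightarrow> gauss S t = t"
    and nz: "\<And>t. t \<in> I \<Longrightarrow> rad1 S t \<noteq> 0" "\<And>t. t \<in> I \<Longrightarrow> rad2 S t \<noteq> 0"
    and cont: "continuous_on I (rad2 S)"
    using S by (auto simp: regular_surface_def)
  have I: "open I" "is_interval I" "I \<noteq> {}" using rev by (auto simp: revolution_surface_def)
  define \<gamma> where "\<gamma> = (\<lambda>t. arcsin (k * radial S t))"
  have dg: "deriv (gauss S) t = 1" if "t \<in> I" for t
  proof -
    have "(gauss S has_real_derivative 1) (at t)"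
      by (rule has_field_derivative_transform_within_open[OF DERIV_ident I(1) that]) (simp add: g)
    then show ?thesis by (rule DERIV_imp_deriv)
  qed
  have drad: "(radial S has_real_derivative rad2 S t * cos t) (at t)" if "t \<in> I" for t
    using revolution_surfaceD(3)[OF rev that] by (simp add: g dg that)
  have b: "-1 < k * radial S t" "k * radial S t < 1" if "t \<in> I" for t
    using small that by (auto simp: abs_less_iff minus_less_iff)
  have sin\<gamma>: "sin (\<gamma> t) = k * radial S t" if "t \<in> I" for t
    unfolding \<gamma>_def using b[OF that] by simp
  have cos\<gamma>: "cos (\<gamma> t) \<noteq> 0" if "t \<in> I" for t
    unfolding \<gamma>_def using b[OF that] by (rule cos_arcsin_nonzero)
  have d\<gamma>: "(\<gamma> has_real_derivative k * rad2 S t * cos t / cos (\<gamma> t)) (at t)" if "t \<in> I" for t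
  proof -
    have "cos (\<gamma> t) = sqrt (1 - (k * radial S t)\<^sup>2)"
      unfolding \<gamma>_def using b[OF that] by (simp add: cos_arcsin)
    then have "(arcsin has_real_derivative inverse (cos (\<gamma> t))) (at (k * radial S t))"
      using DERIV_arcsin[OF b[OF that]] by simp
    from DERIV_chain2[OF this DERIV_cmult[OF drad[OF that], of k]] show ?thesis
      unfolding \<gamma>_def by (simp add: field_simps)
  qed
  have "continuous_on I \<gamma>" "continuous_on I (radial S)"
    using d\<gamma> drad by (meson DERIV_isCont continuous_at_imp_continuous_on)+
  \<comment> \<open>This is the required derivative of the height: the factor \<open>rad2 S\<close>
    in the derivative of \<open>\<gamma>\<close> cancels against the new radius
    \<open>- 1 / rad2 S\<close>.\<close>
  then have "continuous_on I (\<lambda>t. k * cos t * sin (\<gamma> t) / cos (\<gamma> t))"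
    using cos\<gamma> by (intro continuous_intros) auto
  then obtain F where F:
    "\<And>t. t \<in> I \<Longrightarrow> (F has_real_derivative k * cos t * sin (\<gamma> t) / cos (\<gamma> t)) (at t)"
    using antiderivative_on_open_interval[OF I(1,2)] by blast
  define U where "U = \<lparr>gauss = \<gamma>, radial = \<lambda>t. - k * sin t, height = F,
     rad1 = \<lambda>t. - 1 / rad1 S t, rad2 = \<lambda>t. - 1 / rad2 S t\<rparr>"
  have "revolution_surface I U"
    unfolding revolution_surface_def
  proof (intro conjI ballI I)
    fix t assume t: "t \<in> I"
    note [simp] = nz[OF t] cos\<gamma>[OF t] DERIV_imp_deriv[OF d\<gamma>[OF t]]
    show "gauss U differentiable at t"
      using d\<gamma>[OF t] by (auto simp: U_def real_differentiable_def)
    show "radial U t = rad1 U t * sin (gauss U t)"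
      using revolution_surfaceD(2)[OF rev t] by (simp add: U_def sin\<gamma> t g)
    have "(radial U has_real_derivative - k * cos t) (at t)"
      unfolding U_def by (auto intro!: derivative_eq_intros)
    then show "(radial U has_real_derivative rad2 U t * cos (gauss U t) * deriv (gauss U) t) (at t)"
      by (simp add: U_def)
    show "(height U has_real_derivative - rad2 U t * sin (gauss U t) * deriv (gauss U) t) (at t)"
      using F[OF t] by (simp add: U_def field_simps)
  qed
  with rev nz show ?thesis
    by (intro exI[of _ U])
      (auto simp: induced_def reciprocal_matrix_def U_def sin\<gamma> g)
qed

lemma bounded_radial_is_composition:
  fixes M :: "real ^ 2 ^ 2"
  assumes M: "det M = 1" and A: "A \<noteq> 0"
  shows "\<exists>T. is_composition T \<and>
    (\<forall>I S S'. regular_surface I S \<and> (\<forall>t\<in>I. \<bar>radial S t\<bar> \<le> B) \<longrightarrow>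
      (induced M A I S S' \<longleftrightarrow> T I S S'))"
proof (cases "M $ 2 $ 1 = 0")
  case False
  with lower_left_nonzero_is_composition[OF M _ A] show ?thesis by blast
next
  case True
  \<comment> \<open>Then \<open>\<bar>k * radial S t\<bar> < 1\<close>; the absolute value keeps
    \<open>k\<close> positive even for negative \<open>B\<close>.\<close>
  define k where "k = 1 / (\<bar>B\<bar> + 1)"
  have k: "k > 0" by (simp add: k_def add_nonneg_pos)
  \<comment> \<open>The square of \<open>reciprocal_matrix\<close> is minus the identity, so its
    negative is its inverse. The lower left entry of \<open>N\<close> is \<open>- d\<close>, which
    is nonzero because \<open>a * d = 1\<close>.\<close>
  define N where "N = M ** (- reciprocal_matrix)"
  have M_eq: "N ** reciprocal_matrix = M"
    by (simp add: N_def vec_eq_iff forall_2 matrix_mult_2 reciprocal_matrix_def)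
  have "det N = 1" "N $ 2 $ 1 \<noteq> 0"
    using M True by (auto simp: N_def det_2 matrix_mult_2 reciprocal_matrix_def algebra_simps)
  then obtain T where T: "is_composition T" "\<And>I S S'. induced N (A / k) I S S' \<longleftrightarrow> T I S S'"
    using lower_left_nonzero_is_composition[of N "A / k"] A k by auto
  have "is_composition (\<lambda>I. reciprocal k I OO T I)"
    using T(1) k by (intro is_composition.intros) auto
  moreover have "induced M A I S S' \<longleftrightarrow> (reciprocal k I OO T I) S S'"
    if S: "regular_surface I S" "\<forall>t\<in>I. \<bar>radial S t\<bar> \<le> B" for I S S'
  proof -
    have "\<bar>k * radial S t\<bar> < 1" if "t \<in> I" for t
    proof -
      have "\<bar>radial S t\<bar> < \<bar>B\<bar> + 1" using S(2) that by force
      then show ?thesis by (simp add: k_def abs_mult)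
    qed
    then obtain U where U: "induced reciprocal_matrix k I S U"
      using reciprocal_exists[OF S(1)] by blast
    \<comment> \<open>Reciprocal images are not unique: the direction from the composition to
      \<open>M\<close> needs every \<open>V\<close>, the other one takes
      \<open>V = U\<close>.\<close>
    have "induced M A I S S' \<longleftrightarrow> T I V S'" if "induced reciprocal_matrix k I S V" for V
      using induced_mult_iff[OF that, of N "A / k" S'] T(2) k by (simp add: M_eq)
    with U show ?thesis by (auto simp: reciprocal_eq)
  qed
  ultimately show ?thesis by blast
qed

section \<open>Upper triangular matrices that keep the normals\<close>

lemma unit_normal_eq_iff:
  "(\<forall>\<phi>. unit_normal S' t \<phi> = unit_normal S t \<phi>) \<longleftrightarrow>
     sin (gauss S' t) = sin (gauss S t) \<and> cos (gauss S' t) = cos (gauss S t)"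
proof
  assume "\<forall>\<phi>. unit_normal S' t \<phi> = unit_normal S t \<phi>"
  then have "unit_normal S' t 0 = unit_normal S t 0" by blast
  then show "sin (gauss S' t) = sin (gauss S t) \<and> cos (gauss S' t) = cos (gauss S t)"
    by (simp add: unit_normal_def vec_eq_iff forall_3)
qed (simp add: unit_normal_def)

text \<open>Differentiating the sine and the cosine gives two equations for \<open>f'\<close> and
  \<open>g'\<close> whose coefficients do not both vanish. Thus no multiple of \<open>2 * pi\<close>
  has to be tracked.\<close>

lemma deriv_eq_if_sin_cos_eq:
  fixes f g :: "real \<Rightarrow> real"
  assumes "open I" "t \<in> I" "(f has_real_derivative f') (at t)" "(g has_real_derivative g') (at t)"
    and eq: "\<And>x. x \<in> I \<Longrightarrow> sin (f x) = sin (g x)" "\<And>x. x \<in> I \<Longrightarrow> cos (f x) = cos (g x)"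
  shows "f' = g'"
proof -
  have "((\<lambda>x. sin (f x)) has_real_derivative cos (f t) * f') (at t)"
    using assms(3) by (auto intro!: derivative_eq_intros)
  then have "((\<lambda>x. sin (g x)) has_real_derivative cos (f t) * f') (at t)"
    by (rule has_field_derivative_transform_within_open[OF _ assms(1,2)]) (simp add: eq)
  moreover have "((\<lambda>x. sin (g x)) has_real_derivative cos (g t) * g') (at t)"
    using assms(4) by (auto intro!: derivative_eq_intros)
  ultimately have s: "cos (f t) * f' = cos (g t) * g'" by (rule DERIV_unique)
  have "((\<lambda>x. cos (f x)) has_real_derivative - sin (f t) * f') (at t)"
    using assms(3) by (auto intro!: derivative_eq_intros)
  then have "((\<lambda>x. cos (g x)) has_real_derivative - sin (f t) * f') (at t)"
    by (rule has_field_derivative_transform_within_open[OF _ assms(1,2)]) (simp add: eq)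
  moreover have "((\<lambda>x. cos (g x)) has_real_derivative - sin (g t) * g') (at t)"
    using assms(4) by (auto intro!: derivative_eq_intros)
  ultimately have c: "- sin (f t) * f' = - sin (g t) * g'" by (rule DERIV_unique)
  have "cos (g t) = 0 \<Longrightarrow> sin (g t) \<noteq> 0" by (metis sin_cos_squared_add power_zero_numeral add_0 zero_neq_one)
  with s c eq assms(2) show ?thesis by (cases "cos (g t) = 0") auto
qed

text \<open>With the constant \<open>M $ 1 $ 1\<close> the sine of the Gauss angle is already kept,
  since \<open>a * d = 1\<close>; the condition on the normals fixes the sign of the cosine.\<close>

lemma normal_preserving_is_composition:
  fixes M :: "real ^ 2 ^ 2"
  assumes M: "det M = 1" and c0: "M $ 2 $ 1 = 0"
  shows "\<exists>T. is_composition T \<and>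
    (\<forall>I S S'. induced M (M $ 1 $ 1) I S S' \<and> (\<forall>t\<in>I. \<forall>\<phi>. unit_normal S' t \<phi> = unit_normal S t \<phi>)
      \<longleftrightarrow> T I S S')"
proof -
  define a where "a = M $ 1 $ 1"
  define b where "b = M $ 1 $ 2"
  have ad: "a * M $ 2 $ 2 = 1" using M c0 by (simp add: det_2 a_def)
  then have a: "a \<noteq> 0" by auto
  have d: "M $ 2 $ 2 = 1 / a" using ad a by (simp add: field_simps)
  \<comment> \<open>Splitting \<open>a\<close> as \<open>(a / 2) * 2\<close> makes one factor equal
    to 4, so that moving its centre yields any vertical shift. A single homothety could not do so
    for \<open>a\<^sup>2 = 1\<close>.\<close>
  have M_eq: "translation_matrix (a * b) ** (scaling_matrix (a / 2) ** scaling_matrix 2) = M"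
    using a d c0 by (simp add: vec_eq_iff forall_2 matrix_mult_2 translation_matrix_def
        scaling_matrix_def a_def b_def)
  define T where "T = (\<lambda>I. (\<lambda>I. homothety 2 I OO homothety (a / 2) I) I
    OO parallel_translation (a * b) I)"
  have "is_composition T"
    unfolding T_def using a by (intro is_composition.intros) auto
  moreover have "induced M a I S S' \<and> (\<forall>t\<in>I. \<forall>\<phi>. unit_normal S' t \<phi> = unit_normal S t \<phi>)
      \<longleftrightarrow> T I S S'" for I S S'
  proof
    assume "T I S S'"
    then obtain U V where U: "homothety 2 I S U" and V: "homothety (a / 2) I U V"
      and S': "parallel_translation (a * b) I V S'"
      by (auto simp: T_def)
    have "induced (scaling_matrix (a / 2) ** scaling_matrix 2) (a / 2 * 2) I S V"
      unfolding induced_mult_iff[OF homothety_imp_induced[OF U]]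
      by (rule homothety_imp_induced[OF V])
    from induced_mult_iff[OF this, of "translation_matrix (a * b)" 1 S']
    have "induced M a I S S'"
      using parallel_translation_imp_induced[OF S'] by (simp add: M_eq)
    then show "induced M a I S S' \<and> (\<forall>t\<in>I. \<forall>\<phi>. unit_normal S' t \<phi> = unit_normal S t \<phi>)"
      using U V S' a by (auto simp: homothety_iff parallel_translation_iff)
  next
    assume *: "induced M a I S S' \<and> (\<forall>t\<in>I. \<forall>\<phi>. unit_normal S' t \<phi> = unit_normal S t \<phi>)"
    then have S: "revolution_surface I S" "revolution_surface I S'"
      by (auto dest: induced_imp_revolution_surface)
    then have I: "open I" "is_interval I" by (auto simp: revolution_surface_def)
    have sc: "sin (gauss S' t) = sin (gauss S t)" "cos (gauss S' t) = cos (gauss S t)"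
      if "t \<in> I" for t
      using * that unit_normal_eq_iff by blast+
    have r2: "rad2 S' t = a\<^sup>2 * rad2 S t + a * b" if "t \<in> I" for t
      using * that c0 d a
      by (simp add: induced_def Let_def a_def[symmetric] b_def[symmetric] power2_eq_square algebra_simps)
    \<comment> \<open>The subtracted term is the height after a dilation of factor
      \<open>a\<^sup>2\<close> with centre at height 0 and a translation by
      \<open>a * b\<close>.\<close>
    have "((\<lambda>t. height S' t - (a\<^sup>2 * height S t + a * b * cos (gauss S t)))
        has_real_derivative 0) (at t)" if t: "t \<in> I" for t
    proof -
      have "deriv (gauss S') t = deriv (gauss S) t"
        using deriv_eq_if_sin_cos_eq[OF I(1) t revolution_surfaceD(1)[OF S(2) t]
          revolution_surfaceD(1)[OF S(1) t]] sc by blast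
      then have "(height S' has_real_derivative
          - (a\<^sup>2 * rad2 S t + a * b) * sin (gauss S t) * deriv (gauss S) t) (at t)"
        using revolution_surfaceD(4)[OF S(2) t] by (simp add: r2 sc t)
      from this show ?thesis
        by (auto intro!: derivative_eq_intros revolution_surfaceD(1,4)[OF S(1) t] simp: algebra_simps)
    qed
    then have "\<exists>K. \<forall>t\<in>I. height S' t - (a\<^sup>2 * height S t + a * b * cos (gauss S t)) = K"
      using I by (intro has_field_derivative_zero_constant)
        (auto simp: is_interval_convex_1 intro: has_field_derivative_at_within)
    then obtain K where
      K: "\<And>t. t \<in> I \<Longrightarrow> height S' t = a\<^sup>2 * height S t + a * b * cos (gauss S t) + K"
      by (force simp: algebra_simps)
    \<comment> \<open>The dilation of factor 4 with centre \<open>z\<close> shifts the heights by \<open>- 3 z\<close>,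
      which the dilation of factor \<open>(a / 2)\<^sup>2\<close> turns into \<open>K\<close>.\<close>
    define z where "z = - 4 * K / (3 * a\<^sup>2)"
    define U where "U = dilate z (2\<^sup>2) S"
    define V where "V = dilate 0 ((a / 2)\<^sup>2) U"
    have U: "homothety 2 I S U"
      unfolding U_def by (rule homothety_dilate[OF S(1)]) simp
    have V: "homothety (a / 2) I U V"
      unfolding V_def U_def using a
      by (intro homothety_dilate revolution_surface_dilate S) simp
    have "induced (scaling_matrix (a / 2) ** scaling_matrix 2) (a / 2 * 2) I S V"
      unfolding induced_mult_iff[OF homothety_imp_induced[OF U]]
      by (rule homothety_imp_induced[OF V])
    from induced_mult_iff[OF this, of "translation_matrix (a * b)" 1 S']
    have "induced (translation_matrix (a * b)) 1 I V S'"
      using * by (simp add: M_eq)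
    moreover have "height V t = a\<^sup>2 * height S t + K" for t
      using a by (simp add: V_def U_def dilate_def z_def field_simps power2_eq_square)
    moreover have "gauss V = gauss S"
      by (simp add: V_def U_def dilate_def)
    ultimately have "parallel_translation (a * b) I V S'"
      using * by (simp add: parallel_translation_iff K unit_normal_def)
    with U V show "T I S S'" by (auto simp: T_def)
  qed
  ultimately show ?thesis unfolding a_def by blast
qed

text \<open>\<open>T\<close> is chosen before the surfaces. It depends on \<open>B\<close> in the
  second clause, where the constant of the first reciprocal mapping may have to be adapted to the
  radius; the chain behind the third clause contains no reciprocal mapping.\<close>

theorem theorem4p14:
  fixes M :: "real ^ 2 ^ 2" and A :: real
  assumes "det M = 1" and "A \<noteq> 0"
  shows "(M $ 2 $ 1 \<noteq> 0 \<longrightarrow>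
           (\<exists>T. is_composition T \<and>
             (\<forall>I S S'. regular_surface I S \<longrightarrow> (induced M A I S S' \<longleftrightarrow> T I S S'))))
       \<and> (\<forall>B. \<exists>T. is_composition T \<and>
             (\<forall>I S S'. regular_surface I S \<and> (\<forall>t\<in>I. \<bar>radial S t\<bar> \<le> B) \<longrightarrow>
                (induced M A I S S' \<longleftrightarrow> T I S S')))
       \<and> (M $ 2 $ 1 = 0 \<and> A = M $ 1 $ 1 \<longrightarrow>
           (\<exists>T. is_composition T \<and>
             (\<forall>I S S'. regular_surface I S \<longrightarrow>
                (induced M A I S S' \<and> (\<forall>t\<in>I. \<forall>\<phi>. unit_normal S' t \<phi> = unit_normal S t \<phi>)
                  \<longleftrightarrow> T I S S'))))"
proof (intro conjI impI allI)
  assume "M $ 2 $ 1 \<noteq> 0"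
  with lower_left_nonzero_is_composition[OF assms(1) _ assms(2)]
  show "\<exists>T. is_composition T \<and>
      (\<forall>I S S'. regular_surface I S \<longrightarrow> (induced M A I S S' \<longleftrightarrow> T I S S'))"
    by blast
next
  fix B
  show "\<exists>T. is_composition T \<and>
      (\<forall>I S S'. regular_surface I S \<and> (\<forall>t\<in>I. \<bar>radial S t\<bar> \<le> B) \<longrightarrow>
        (induced M A I S S' \<longleftrightarrow> T I S S'))"
    by (rule bounded_radial_is_composition[OF assms])
next
  assume "M $ 2 $ 1 = 0 \<and> A = M $ 1 $ 1"
  with normal_preserving_is_composition[OF assms(1)]
  show "\<exists>T. is_composition T \<and>
      (\<forall>I S S'. regular_surface I S \<longrightarrow>
        (induced M A I S S' \<and> (\<forall>t\<in>I. \<forall>\<phi>. unit_normal S' t \<phi> = unit_normal S t \<phi>)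
          \<longleftrightarrow> T I S S'))"
    by blast
qed

end
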